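(* Let $G$ and $H$ be groups, considered as categories. Then limits over $G$ commute with colimits over $H$ in $\mathbf{Set}$ if and only if no nontrivial quotient group of $G$ is isomorphic to a subquotient group of $H$.
   Context: Groups are arbitrary (not necessarily finite). A group is considered as a category with one object, whose morphisms are the elements of the group and whose composition is the group multiplication. For small categories $\mathbb{I}$ and $\mathbb{J}$, limits over $\mathbb{I}$ commute with colimits over $\mathbb{J}$ in $\mathbf{Set}$ if, for every functor $F:\mathbb{I}\times\mathbb{J}\to\mathbf{Set}$, the canonical map $\operatorname{colim}_{j\in\mathbb{J}}\lim_{i\in\mathbb{I}}F(i,j)\to\lim_{i\in\mathbb{I}}\operatorname{colim}_{j\in\mathbb{J}}F(i,j)$ is a bijection. A subquotient group of $H$ is a group of the form $K/L$ with $K$ a subgroup of $H$ and $L$ a normal subgroup of $K$. *)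

theory Defs
  imports "HOL-Algebra.Algebra" "HOL-Library.Equipollence"
begin

section \<open>Small categories\<close>

record ('o, 'm) category =
  Obj :: "'o set"
  Arr :: "'m set"
  Dom :: "'m \<Rightarrow> 'o"
  Cod :: "'m \<Rightarrow> 'o"
  Ident :: "'o \<Rightarrow> 'm"
  Comp :: "'m \<Rightarrow> 'm \<Rightarrow> 'm"

text \<open>\<open>Comp C g f\<close> is the composite "first \<open>f\<close>, then \<open>g\<close>".\<close>

locale small_category =
  fixes C :: "('o, 'm) category"
  assumes Dom_closed: "f \<in> Arr C \<Longrightarrow> Dom C f \<in> Obj C"
    and Cod_closed: "f \<in> Arr C \<Longrightarrow> Cod C f \<in> Obj C"
    and Ident_closed: "a \<in> Obj C \<Longrightarrow> Ident C a \<in> Arr C"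
    and Dom_Ident: "a \<in> Obj C \<Longrightarrow> Dom C (Ident C a) = a"
    and Cod_Ident: "a \<in> Obj C \<Longrightarrow> Cod C (Ident C a) = a"
    and Comp_closed:
      "\<lbrakk>f \<in> Arr C; g \<in> Arr C; Cod C f = Dom C g\<rbrakk> \<Longrightarrow> Comp C g f \<in> Arr C"
    and Dom_Comp:
      "\<lbrakk>f \<in> Arr C; g \<in> Arr C; Cod C f = Dom C g\<rbrakk> \<Longrightarrow> Dom C (Comp C g f) = Dom C f"
    and Cod_Comp:
      "\<lbrakk>f \<in> Arr C; g \<in> Arr C; Cod C f = Dom C g\<rbrakk> \<Longrightarrow> Cod C (Comp C g f) = Cod C g"
    and Comp_Ident_left: "f \<in> Arr C \<Longrightarrow> Comp C (Ident C (Cod C f)) f = f"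
    and Comp_Ident_right: "f \<in> Arr C \<Longrightarrow> Comp C f (Ident C (Dom C f)) = f"
    and Comp_assoc:
      "\<lbrakk>f \<in> Arr C; g \<in> Arr C; h \<in> Arr C; Cod C f = Dom C g; Cod C g = Dom C h\<rbrakk>
        \<Longrightarrow> Comp C h (Comp C g f) = Comp C (Comp C h g) f"

definition prod_category ::
    "('o, 'm) category \<Rightarrow> ('p, 'n) category \<Rightarrow> ('o \<times> 'p, 'm \<times> 'n) category" where
  "prod_category I J =
    \<lparr>Obj = Obj I \<times> Obj J,
     Arr = Arr I \<times> Arr J,
     Dom = (\<lambda>(f, g). (Dom I f, Dom J g)),
     Cod = (\<lambda>(f, g). (Cod I f, Cod J g)),
     Ident = (\<lambda>(i, j). (Ident I i, Ident J j)),
     Comp = (\<lambda>(f', g') (f, g). (Comp I f' f, Comp J g' g))\<rparr>"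

definition group_category :: "('g, 'a) monoid_scheme \<Rightarrow> (unit, 'g) category" where
  "group_category G =
    \<lparr>Obj = {()},
     Arr = carrier G,
     Dom = (\<lambda>_. ()),
     Cod = (\<lambda>_. ()),
     Ident = (\<lambda>_. \<one>\<^bsub>G\<^esub>),
     Comp = (\<lambda>g f. g \<otimes>\<^bsub>G\<^esub> f)\<rparr>"

lemma small_category_prod:
  assumes "small_category I" "small_category J"
  shows "small_category (prod_category I J)"
proof -
  interpret I: small_category I by fact
  interpret J: small_category J by fact
  show ?thesis
    by unfold_locales
      (auto simp: prod_category_def I.Dom_closed I.Cod_closed I.Ident_closed I.Dom_Ident
        I.Cod_Ident I.Comp_closed I.Dom_Comp I.Cod_Comp I.Comp_Ident_left I.Comp_Ident_right
        I.Comp_assoc J.Dom_closed J.Cod_closed J.Ident_closed J.Dom_Ident J.Cod_Ident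
        J.Comp_closed J.Dom_Comp J.Cod_Comp J.Comp_Ident_left J.Comp_Ident_right J.Comp_assoc)
qed

lemma (in group) small_category_group: "small_category (group_category G)"
  by unfold_locales (auto simp: group_category_def m_assoc)

section \<open>Functors to sets, limits and colimits\<close>

text \<open>
  \<open>Set\<close> is modelled by the subsets of a type \<open>'u\<close>. A function between two such sets is
  a HOL function of which only the values on the source set matter. Since no HOL type
  contains all sets, \<open>'u\<close> plays the role of a universe, in which the categories
  under consideration have to be small (embed into \<open>'u\<close>).
\<close>

record ('o, 'm, 'u) set_diagram =
  fobj :: "'o \<Rightarrow> 'u set"
  farr :: "'m \<Rightarrow> 'u \<Rightarrow> 'u"

definition set_functor :: "('o, 'm) category \<Rightarrow> ('o, 'm, 'u) set_diagram \<Rightarrow> bool" where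
  "set_functor C F \<longleftrightarrow>
    (\<forall>f \<in> Arr C. farr F f \<in> fobj F (Dom C f) \<rightarrow> fobj F (Cod C f)) \<and>
    (\<forall>a \<in> Obj C. \<forall>x \<in> fobj F a. farr F (Ident C a) x = x) \<and>
    (\<forall>f \<in> Arr C. \<forall>g \<in> Arr C. Cod C f = Dom C g \<longrightarrow>
      (\<forall>x \<in> fobj F (Dom C f). farr F (Comp C g f) x = farr F g (farr F f x)))"

text \<open>The limit is the set of compatible families.\<close>

definition set_lim :: "('o, 'm) category \<Rightarrow> ('o, 'm, 'u) set_diagram \<Rightarrow> ('o \<Rightarrow> 'u) set" where
  "set_lim C F =
    {x \<in> \<Pi>\<^sub>E i \<in> Obj C. fobj F i. \<forall>f \<in> Arr C. farr F f (x (Dom C f)) = x (Cod C f)}"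

text \<open>
  The colimit is the disjoint union of the sets \<open>fobj F j\<close> modulo the equivalence relation
  generated by \<open>(Dom f, x) ~ (Cod f, F f x)\<close>.
\<close>

definition elements :: "('o, 'm) category \<Rightarrow> ('o, 'm, 'u) set_diagram \<Rightarrow> ('o \<times> 'u) set" where
  "elements C F = (SIGMA j : Obj C. fobj F j)"

definition colim_step ::
    "('o, 'm) category \<Rightarrow> ('o, 'm, 'u) set_diagram \<Rightarrow> (('o \<times> 'u) \<times> ('o \<times> 'u)) set" where
  "colim_step C F =
    {((Dom C f, x), (Cod C f, farr F f x)) | f x. f \<in> Arr C \<and> x \<in> fobj F (Dom C f)}"

definition colim_rel ::
    "('o, 'm) category \<Rightarrow> ('o, 'm, 'u) set_diagram \<Rightarrow> (('o \<times> 'u) \<times> ('o \<times> 'u)) set" where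
  "colim_rel C F =
    (colim_step C F \<union> (colim_step C F)\<inverse>)\<^sup>* \<inter> (elements C F \<times> elements C F)"

definition set_colim :: "('o, 'm) category \<Rightarrow> ('o, 'm, 'u) set_diagram \<Rightarrow> ('o \<times> 'u) set set" where
  "set_colim C F = elements C F // colim_rel C F"

lemma equiv_colim_rel: "equiv (elements C F) (colim_rel C F)"
proof (rule equivI)
  have "sym ((colim_step C F \<union> (colim_step C F)\<inverse>)\<^sup>*)"
    by (intro sym_rtrancl sym_Un_converse)
  then show "sym (colim_rel C F)"
    unfolding colim_rel_def sym_def by blast
  show "trans (colim_rel C F)"
    unfolding colim_rel_def trans_def by (blast intro: rtrancl_trans)
qed (auto simp: colim_rel_def refl_on_def)

text \<open>
  The maps induced on limits and colimits by a natural transformation with components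
  \<open>\<phi> i\<close>. On colimits the class of \<open>(j, x)\<close> is sent to the class of
  \<open>(j, \<phi> j x)\<close> in the colimit of the target functor \<open>F'\<close>.
\<close>

definition lim_map :: "('o, 'm) category \<Rightarrow> ('o \<Rightarrow> 'u \<Rightarrow> 'v) \<Rightarrow> ('o \<Rightarrow> 'u) \<Rightarrow> ('o \<Rightarrow> 'v)" where
  "lim_map C \<phi> x = (\<lambda>i \<in> Obj C. \<phi> i (x i))"

definition colim_map ::
    "('o, 'm) category \<Rightarrow> ('o, 'm, 'v) set_diagram \<Rightarrow> ('o \<Rightarrow> 'u \<Rightarrow> 'v) \<Rightarrow>
      ('o \<times> 'u) set \<Rightarrow> ('o \<times> 'v) set" where
  "colim_map C F' \<phi> S = (\<Union>(j, x) \<in> S. colim_rel C F' `` {(j, \<phi> j x)})"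

lemma colim_map_class:
  assumes \<phi>: "\<And>j. j \<in> Obj C \<Longrightarrow> \<phi> j \<in> fobj F j \<rightarrow> fobj F' j"
    and nat: "\<And>f x. f \<in> Arr C \<Longrightarrow> x \<in> fobj F (Dom C f) \<Longrightarrow>
      \<phi> (Cod C f) (farr F f x) = farr F' f (\<phi> (Dom C f) x)"
    and C: "small_category C"
    and jx: "(j, x) \<in> elements C F"
  shows "colim_map C F' \<phi> (colim_rel C F `` {(j, x)}) = colim_rel C F' `` {(j, \<phi> j x)}"
proof -
  let ?\<phi> = "\<lambda>(j, x). (j, \<phi> j x)"
  have step_image: "(?\<phi> p, ?\<phi> q) \<in> colim_step C F' \<union> (colim_step C F')\<inverse>"
    if "(p, q) \<in> colim_step C F \<union> (colim_step C F)\<inverse>" for p q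
    using that \<phi> nat small_category.Dom_closed[OF C] unfolding colim_step_def
    by auto (metis PiE)+
  have rel: "(?\<phi> p, ?\<phi> q) \<in> colim_rel C F'" if "(p, q) \<in> colim_rel C F" for p q
  proof -
    have "(p, q) \<in> (colim_step C F \<union> (colim_step C F)\<inverse>)\<^sup>*"
      using that by (simp add: colim_rel_def)
    then have "(?\<phi> p, ?\<phi> q) \<in> (colim_step C F' \<union> (colim_step C F')\<inverse>)\<^sup>*"
    proof (induction rule: rtrancl_induct)
      case (step q r)
      show ?case
        by (rule rtrancl_into_rtrancl[OF step.IH step_image[OF step.hyps(2)]])
    qed simp
    moreover have "?\<phi> p \<in> elements C F'" "?\<phi> q \<in> elements C F'"
      using that \<phi> by (auto simp: colim_rel_def elements_def)
    ultimately show ?thesis by (simp add: colim_rel_def)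
  qed
  have "congruent (colim_rel C F) (\<lambda>p. colim_rel C F' `` {?\<phi> p})"
    using rel by (auto intro!: congruentI equiv_class_eq[OF equiv_colim_rel])
  from UN_equiv_class[OF equiv_colim_rel this jx]
  show ?thesis by (simp add: colim_map_def case_prod_unfold)
qed

section \<open>Commutation of limits with colimits\<close>

text \<open>For \<open>F\<close> on \<open>I \<times> J\<close>: the functors \<open>F(-, j)\<close> and \<open>F(i, -)\<close>.\<close>

definition fix_right ::
    "('p, 'n) category \<Rightarrow> ('o \<times> 'p, 'm \<times> 'n, 'u) set_diagram \<Rightarrow> 'p \<Rightarrow> ('o, 'm, 'u) set_diagram"
  where
  "fix_right J F j =
    \<lparr>fobj = (\<lambda>i. fobj F (i, j)), farr = (\<lambda>f. farr F (f, Ident J j))\<rparr>"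

definition fix_left ::
    "('o, 'm) category \<Rightarrow> ('o \<times> 'p, 'm \<times> 'n, 'u) set_diagram \<Rightarrow> 'o \<Rightarrow> ('p, 'n, 'u) set_diagram"
  where
  "fix_left I F i =
    \<lparr>fobj = (\<lambda>j. fobj F (i, j)), farr = (\<lambda>g. farr F (Ident I i, g))\<rparr>"

text \<open>The functor on \<open>J\<close> sending \<open>j\<close> to the limit of \<open>F(-, j)\<close>.\<close>

definition lim_diagram ::
    "('o, 'm) category \<Rightarrow> ('p, 'n) category \<Rightarrow> ('o \<times> 'p, 'm \<times> 'n, 'u) set_diagram \<Rightarrow>
      ('p, 'n, 'o \<Rightarrow> 'u) set_diagram" where
  "lim_diagram I J F =
    \<lparr>fobj = (\<lambda>j. set_lim I (fix_right J F j)),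
     farr = (\<lambda>g. lim_map I (\<lambda>i. farr F (Ident I i, g)))\<rparr>"

text \<open>The functor on \<open>I\<close> sending \<open>i\<close> to the colimit of \<open>F(i, -)\<close>.\<close>

definition colim_diagram ::
    "('o, 'm) category \<Rightarrow> ('p, 'n) category \<Rightarrow> ('o \<times> 'p, 'm \<times> 'n, 'u) set_diagram \<Rightarrow>
      ('o, 'm, ('p \<times> 'u) set) set_diagram" where
  "colim_diagram I J F =
    \<lparr>fobj = (\<lambda>i. set_colim J (fix_left I F i)),
     farr = (\<lambda>f. colim_map J (fix_left I F (Cod I f)) (\<lambda>j. farr F (f, Ident J j)))\<rparr>"

text \<open>
  The canonical map sends the class of \<open>(j, x)\<close>, with \<open>x\<close> a compatible family, to the
  family of the classes of \<open>(j, x i)\<close>: its component at \<open>i\<close> is induced by the limit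
  projections \<open>lim F(-, j) \<rightarrow> F(i, j)\<close>.
\<close>

definition canonical_map ::
    "('o, 'm) category \<Rightarrow> ('p, 'n) category \<Rightarrow> ('o \<times> 'p, 'm \<times> 'n, 'u) set_diagram \<Rightarrow>
      ('p \<times> ('o \<Rightarrow> 'u)) set \<Rightarrow> ('o \<Rightarrow> ('p \<times> 'u) set)" where
  "canonical_map I J F S = (\<lambda>i \<in> Obj I. colim_map J (fix_left I F i) (\<lambda>j x. x i) S)"

definition limits_commute_with_colimits ::
    "'u itself \<Rightarrow> ('o, 'm) category \<Rightarrow> ('p, 'n) category \<Rightarrow> bool" where
  "limits_commute_with_colimits (_ :: 'u itself) I J \<longleftrightarrow>
    (\<forall>F :: ('o \<times> 'p, 'm \<times> 'n, 'u) set_diagram. set_functor (prod_category I J) F \<longrightarrow>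
      bij_betw (canonical_map I J F)
        (set_colim J (lim_diagram I J F)) (set_lim I (colim_diagram I J F)))"

end

theory Submission
  imports Defs
begin

text \<open>
  A functor \<open>G \<times> H \<rightarrow> Set\<close> is a set with commuting actions of \<open>G\<close> and \<open>H\<close>, and the canonical
  map sends the \<open>H\<close>-orbit of a \<open>G\<close>-fixed point to that orbit in the set of all \<open>G\<close>-stable
  \<open>H\<close>-orbits. It is always injective, and it is surjective iff every point \<open>x\<close> whose \<open>H\<close>-orbit
  is \<open>G\<close>-stable is itself fixed by \<open>G\<close>. For such an \<open>x\<close> the quotient of \<open>G\<close> by the stabilizer
  of \<open>x\<close> is isomorphic to \<open>K/L\<close>, where \<open>K = {h. h x \<in> G x}\<close> and \<open>L\<close> is the stabilizer in
  \<open>H\<close>.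
\<close>

section \<open>Limits and colimits over a one-object category\<close>

lemma group_category_simps [simp]:
  "Obj (group_category G) = {()}"
  "Arr (group_category G) = carrier G"
  "Dom (group_category G) g = ()"
  "Cod (group_category G) g = ()"
  "Ident (group_category G) u = \<one>\<^bsub>G\<^esub>"
  "Comp (group_category G) g h = g \<otimes>\<^bsub>G\<^esub> h"
  by (auto simp: group_category_def)

lemma restrict_unit: "restrict f {()} = f"
  by (auto simp: restrict_def)

text \<open>A family over the only object is a single point, and compatibility with the arrows says
  that every group element fixes it. The limit is thus the fixed-point set, each point being stored
  as a constant function on \<open>unit\<close>.\<close>

lemma set_lim_group_category:
  "set_lim (group_category G) F =
    {\<lambda>_. x | x. x \<in> fobj F () \<and> (\<forall>g \<in> carrier G. farr F g x = x)}"
proof -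
  have "\<exists>y. x = (\<lambda>_. y) \<and> P y" if "P (x ())" for x :: "unit \<Rightarrow> 'u" and P
    using that by (intro exI[of _ "x ()"]) auto
  then show ?thesis
    by (fastforce simp: set_lim_def PiE_def extensional_def)
qed

text \<open>One step of the generating relation already gives an equivalence relation: the unit,
  inverses and products of the group yield reflexivity, symmetry and transitivity. Hence the colimit
  classes are the orbits.\<close>

lemma colim_rel_group_category:
  assumes H: "group H" and F: "set_functor (group_category H) F"
  shows "colim_rel (group_category H) F =
    {(((), x), ((), farr F h x)) | x h. x \<in> fobj F () \<and> h \<in> carrier H}"
    (is "_ = ?R")
proof -
  interpret group H by fact
  let ?E = "elements (group_category H) F" and ?S = "colim_step (group_category H) F"
  have cl: "farr F h x \<in> fobj F ()" if "x \<in> fobj F ()" "h \<in> carrier H" for x h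
    using F that by (auto simp: set_functor_def)
  have one: "farr F \<one>\<^bsub>H\<^esub> x = x" if "x \<in> fobj F ()" for x
    using F that by (auto simp: set_functor_def)
  have mult: "farr F (h \<otimes>\<^bsub>H\<^esub> k) x = farr F h (farr F k x)"
    if "x \<in> fobj F ()" "h \<in> carrier H" "k \<in> carrier H" for x h k
    using F that by (auto simp: set_functor_def)
  have S: "?S = ?R" and E: "?E = {()} \<times> fobj F ()"
    by (auto simp: colim_step_def elements_def)
  \<comment> \<open>Along a zigzag starting at \<open>p\<close>, every point reached stays of the
    form \<open>h x\<close>: a forward step by \<open>k\<close> replaces \<open>h\<close> by
    \<open>k h\<close>, a backward step replaces it by \<open>inv k h\<close>.\<close>
  have "q \<in> ?E \<and> (p, q) \<in> ?R" if "(p, q) \<in> (?S \<union> ?S\<inverse>)\<^sup>*" "p \<in> ?E" for p q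
    using that
  proof (induction rule: rtrancl_induct)
    case base
    then show ?case
      using one[symmetric] by (force simp: E)
  next
    case (step q r)
    obtain x h where p: "p = ((), x)" "q = ((), farr F h x)"
      and x: "x \<in> fobj F ()" and h: "h \<in> carrier H"
      using step by auto
    from step.hyps(2) consider k where "k \<in> carrier H" "r = ((), farr F k (farr F h x))"
      | k y where "k \<in> carrier H" "y \<in> fobj F ()" "r = ((), y)" "farr F k y = farr F h x"
      by (auto simp: S p)
    then show ?case
    proof cases
      case (1 k)
      then have "r = ((), farr F (k \<otimes>\<^bsub>H\<^esub> h) x)"
        using x h mult by simp
      then show ?thesis
        using p x h 1(1) cl by (auto simp: E)
    next
      case (2 k y)
      have "y = farr F (inv\<^bsub>H\<^esub> k) (farr F k y)"
        using 2 mult[of y "inv\<^bsub>H\<^esub> k" k] one by simp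
      then have "y = farr F (inv\<^bsub>H\<^esub> k \<otimes>\<^bsub>H\<^esub> h) x"
        using 2 x h mult by simp
      moreover have "inv\<^bsub>H\<^esub> k \<otimes>\<^bsub>H\<^esub> h \<in> carrier H"
        using 2 h by simp
      ultimately show ?thesis
        using p x 2 by (auto simp: E)
    qed
  qed
  moreover have "?R \<subseteq> ?E \<times> ?E"
    using cl by (auto simp: E)
  moreover have "?R \<subseteq> (?S \<union> ?S\<inverse>)\<^sup>*"
    unfolding S by blast
  ultimately show ?thesis
    unfolding colim_rel_def by blast
qed

section \<open>Diagrams over the product as commuting actions\<close>

locale commuting_actions = G: group G + H: group H
  for G :: "('g, 'a) monoid_scheme" and H :: "('h, 'b) monoid_scheme" +
  fixes F :: "(unit \<times> unit, 'g \<times> 'h, 'u) set_diagram"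
  assumes F_functor: "set_functor (prod_category (group_category G) (group_category H)) F"
begin

definition pts where "pts = fobj F ((), ())"
definition lact where "lact g = farr F (g, \<one>\<^bsub>H\<^esub>)"
text \<open>The name refers to the second factor of the product; by functoriality this is a left
  action of \<open>H\<close>.\<close>

definition ract where "ract h = farr F (\<one>\<^bsub>G\<^esub>, h)"
text \<open>The tag \<open>()\<close> is kept so that an orbit is literally a class of the colimit
  over \<open>H\<close>.\<close>

definition orbit where "orbit x = {((), ract h x) | h. h \<in> carrier H}"

lemma farr_mult:
  assumes "x \<in> pts" "g \<in> carrier G" "g' \<in> carrier G" "h \<in> carrier H" "h' \<in> carrier H"
  shows "farr F (g \<otimes>\<^bsub>G\<^esub> g', h \<otimes>\<^bsub>H\<^esub> h') x = farr F (g, h) (farr F (g', h') x)"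
  using F_functor assms by (auto simp: set_functor_def prod_category_def pts_def)

lemma farr_closed:
  assumes "x \<in> pts" "g \<in> carrier G" "h \<in> carrier H"
  shows "farr F (g, h) x \<in> pts"
  using F_functor assms by (auto simp: set_functor_def prod_category_def pts_def)

lemma farr_one: "x \<in> pts \<Longrightarrow> farr F (\<one>\<^bsub>G\<^esub>, \<one>\<^bsub>H\<^esub>) x = x"
  using F_functor by (auto simp: set_functor_def prod_category_def pts_def)

lemma lact_closed [simp]: "x \<in> pts \<Longrightarrow> g \<in> carrier G \<Longrightarrow> lact g x \<in> pts"
  by (simp add: lact_def farr_closed)

lemma ract_closed [simp]: "x \<in> pts \<Longrightarrow> h \<in> carrier H \<Longrightarrow> ract h x \<in> pts"
  by (simp add: ract_def farr_closed)

lemma lact_one [simp]: "x \<in> pts \<Longrightarrow> lact \<one>\<^bsub>G\<^esub> x = x"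
  by (simp add: lact_def farr_one)

lemma ract_one [simp]: "x \<in> pts \<Longrightarrow> ract \<one>\<^bsub>H\<^esub> x = x"
  by (simp add: ract_def farr_one)

lemma lact_mult:
  "x \<in> pts \<Longrightarrow> g \<in> carrier G \<Longrightarrow> g' \<in> carrier G \<Longrightarrow> lact (g \<otimes>\<^bsub>G\<^esub> g') x = lact g (lact g' x)"
  using farr_mult[of x g g' "\<one>\<^bsub>H\<^esub>" "\<one>\<^bsub>H\<^esub>"] by (simp add: lact_def)

lemma ract_mult:
  "x \<in> pts \<Longrightarrow> h \<in> carrier H \<Longrightarrow> h' \<in> carrier H \<Longrightarrow> ract (h \<otimes>\<^bsub>H\<^esub> h') x = ract h (ract h' x)"
  using farr_mult[of x "\<one>\<^bsub>G\<^esub>" "\<one>\<^bsub>G\<^esub>" h h'] by (simp add: ract_def)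

text \<open>Both sides are the action of the single arrow \<open>(g, h)\<close>, which factors as
  \<open>(g, 1) (1, h)\<close> and as \<open>(1, h) (g, 1)\<close>.\<close>

lemma lact_ract:
  assumes "x \<in> pts" "g \<in> carrier G" "h \<in> carrier H"
  shows "lact g (ract h x) = ract h (lact g x)"
  using farr_mult[of x g "\<one>\<^bsub>G\<^esub>" "\<one>\<^bsub>H\<^esub>" h] farr_mult[of x "\<one>\<^bsub>G\<^esub>" g h "\<one>\<^bsub>H\<^esub>"] assms
  by (simp add: lact_def ract_def)

lemma lact_inv [simp]: "x \<in> pts \<Longrightarrow> g \<in> carrier G \<Longrightarrow> lact (inv\<^bsub>G\<^esub> g) (lact g x) = x"
  by (simp flip: lact_mult)

lemma ract_inv [simp]: "x \<in> pts \<Longrightarrow> h \<in> carrier H \<Longrightarrow> ract (inv\<^bsub>H\<^esub> h) (ract h x) = x"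
  by (simp flip: ract_mult)

section \<open>The canonical map in terms of orbits\<close>

lemma colim_rel_fix_left:
  "colim_rel (group_category H) (fix_left (group_category G) F ()) =
    {(((), x), ((), ract h x)) | x h. x \<in> pts \<and> h \<in> carrier H}"
proof -
  have "set_functor (group_category H) (fix_left (group_category G) F ())"
    using ract_closed ract_one ract_mult
    by (auto simp: set_functor_def fix_left_def pts_def ract_def)
  from colim_rel_group_category[OF H.is_group this] show ?thesis
    by (simp add: fix_left_def pts_def ract_def)
qed

lemma set_lim_fix_right:
  "set_lim (group_category G) (fix_right (group_category H) F ()) =
    {\<lambda>_. x | x. x \<in> pts \<and> (\<forall>g \<in> carrier G. lact g x = x)}"
  by (simp add: set_lim_group_category fix_right_def pts_def lact_def)

text \<open>Since the actions commute, \<open>H\<close> preserves the set of \<open>G\<close>-fixed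
  points, so the general description of colimits over a group applies to this set.\<close>

lemma colim_rel_lim_diagram:
  "colim_rel (group_category H) (lim_diagram (group_category G) (group_category H) F) =
    {(((), \<lambda>_. x), ((), \<lambda>_. ract h x)) | x h.
      x \<in> pts \<and> (\<forall>g \<in> carrier G. lact g x = x) \<and> h \<in> carrier H}"
proof -
  let ?D = "lim_diagram (group_category G) (group_category H) F"
  have obj: "fobj ?D () = {\<lambda>_. x | x. x \<in> pts \<and> (\<forall>g \<in> carrier G. lact g x = x)}"
    by (simp add: lim_diagram_def set_lim_fix_right)
  have arr: "farr ?D h s = (\<lambda>i. ract h (s i))" for h s
    by (auto simp: lim_diagram_def lim_map_def ract_def restrict_unit)
  have "set_functor (group_category H) ?D"
    unfolding set_functor_def using lact_ract
    by (auto simp: obj arr ract_mult)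
  from colim_rel_group_category[OF H.is_group this] show ?thesis
    by (auto simp: obj arr)
qed

lemma orbit_eq_iff:
  assumes "x \<in> pts" "y \<in> pts"
  shows "orbit x = orbit y \<longleftrightarrow> (\<exists>h \<in> carrier H. x = ract h y)"
proof
  assume "orbit x = orbit y"
  moreover have "((), x) \<in> orbit x"
    using assms ract_one[of x] by (force simp: orbit_def)
  ultimately show "\<exists>h \<in> carrier H. x = ract h y"
    by (auto simp: orbit_def)
next
  assume "\<exists>h \<in> carrier H. x = ract h y"
  then obtain h where h: "h \<in> carrier H" "x = ract h y" by blast
  have "\<exists>k' \<in> carrier H. ract k x = ract k' y" if "k \<in> carrier H" for k
    using that h assms by (intro bexI[of _ "k \<otimes>\<^bsub>H\<^esub> h"]) (auto simp: ract_mult)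
  moreover have "\<exists>k' \<in> carrier H. ract k y = ract k' x" if "k \<in> carrier H" for k
    using that h assms by (intro bexI[of _ "k \<otimes>\<^bsub>H\<^esub> inv\<^bsub>H\<^esub> h"]) (auto simp: ract_mult)
  ultimately show "orbit x = orbit y"
    unfolding orbit_def by blast
qed

text \<open>Source and target are identified with the orbits of points in \<open>Fix\<close> and in
  \<open>Inv\<close> respectively, and the canonical map becomes the inclusion between these two
  sets of orbits.\<close>

lemma bij_canonical_map_iff:
  "bij_betw (canonical_map (group_category G) (group_category H) F)
      (set_colim (group_category H) (lim_diagram (group_category G) (group_category H) F))
      (set_lim (group_category G) (colim_diagram (group_category G) (group_category H) F)) \<longleftrightarrow>
    (\<forall>x \<in> pts. (\<forall>g \<in> carrier G. \<exists>h \<in> carrier H. lact g x = ract h x) \<longrightarrow>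
      (\<forall>g \<in> carrier G. lact g x = x))"
    (is "bij_betw ?can ?A ?B \<longleftrightarrow> ?R")
proof -
  define Fix where "Fix = {x \<in> pts. \<forall>g \<in> carrier G. lact g x = x}"
  define Inv where "Inv = {x \<in> pts. \<forall>g \<in> carrier G. \<exists>h \<in> carrier H. lact g x = ract h x}"
  \<comment> \<open>This is the class of a fixed point in the source colimit, whose elements are
    constant families rather than points.\<close>
  define horbit where
    "horbit x = {((), \<lambda>_::unit. ract h x) | h. h \<in> carrier H}" for x
  have Fix_Inv: "Fix \<subseteq> Inv"
    using ract_one by (force simp: Fix_def Inv_def)
  have orbit: "colim_rel (group_category H) (fix_left (group_category G) F ()) `` {((), x)}
      = orbit x" if "x \<in> pts" for x
    using that by (auto simp: colim_rel_fix_left orbit_def)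
  have A: "?A = horbit ` Fix"
  proof -
    let ?D = "lim_diagram (group_category G) (group_category H) F"
    have "elements (group_category H) ?D = (\<lambda>x. ((), \<lambda>_. x)) ` Fix"
      by (auto simp: elements_def lim_diagram_def set_lim_fix_right Fix_def)
    moreover have "colim_rel (group_category H) ?D `` {((), \<lambda>_. x)} = horbit x"
      if "x \<in> Fix" for x
      using that by (auto simp: colim_rel_lim_diagram horbit_def Fix_def fun_eq_iff)
    ultimately show ?thesis
      by (auto simp: set_colim_def quotient_def)
  qed
  have colim: "set_colim (group_category H) (fix_left (group_category G) F ()) = orbit ` pts"
    unfolding set_colim_def quotient_def colim_rel_fix_left elements_def orbit_def
    by (auto simp: fix_left_def pts_def)
  \<comment> \<open>The union defining \<open>colim_map\<close> runs over all representatives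
    \<open>ract h x\<close>; as the actions commute, each contributes the same orbit.\<close>
  have map: "colim_map (group_category H) (fix_left (group_category G) F ())
      (\<lambda>j. farr F (g, \<one>\<^bsub>H\<^esub>)) (orbit x) = orbit (lact g x)"
    if x: "x \<in> pts" and g: "g \<in> carrier G" for x g
  proof -
    have "orbit (lact g (ract h x)) = orbit (lact g x)" if "h \<in> carrier H" for h
      using x g that by (auto simp: orbit_eq_iff lact_ract)
    then have orbit_eq: "colim_rel (group_category H) (fix_left (group_category G) F ()) ``
        {((), lact g (ract h x))} = orbit (lact g x)" if "h \<in> carrier H" for h
      using x g that orbit by simp
    have "colim_map (group_category H) (fix_left (group_category G) F ())
        (\<lambda>j. farr F (g, \<one>\<^bsub>H\<^esub>)) (orbit x) = (\<Union>h \<in> carrier H.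
        colim_rel (group_category H) (fix_left (group_category G) F ()) `` {((), lact g (ract h x))})"
      unfolding colim_map_def orbit_def lact_def by blast
    also have "\<dots> = (\<Union>h \<in> carrier H. orbit (lact g x))"
      using orbit_eq by (intro SUP_cong) auto
    also have "\<dots> = orbit (lact g x)"
      using H.one_closed by blast
    finally show ?thesis .
  qed
  have B: "?B = (\<lambda>x _. orbit x) ` Inv"
  proof -
    let ?m = "\<lambda>g. colim_map (group_category H) (fix_left (group_category G) F ())
      (\<lambda>j. farr F (g, \<one>\<^bsub>H\<^esub>))"
    \<comment> \<open>By \<open>map\<close>, an orbit is preserved by \<open>g\<close> exactly when
      \<open>lact g x\<close> lies in the orbit of \<open>x\<close>, which is the condition in
      \<open>Inv\<close>.\<close>
    have inv_iff: "(\<forall>g \<in> carrier G. ?m g (orbit x) = orbit x) \<longleftrightarrow> x \<in> Inv" if "x \<in> pts" for x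
      using that map orbit_eq_iff by (simp add: Inv_def)
    have "?B = {\<lambda>_. c | c. c \<in> orbit ` pts \<and> (\<forall>g \<in> carrier G. ?m g c = c)}"
      unfolding set_lim_group_category colim[symmetric]
      by (simp add: colim_diagram_def)
    also have "\<dots> = (\<lambda>x _. orbit x) ` {x \<in> pts. \<forall>g \<in> carrier G. ?m g (orbit x) = orbit x}"
      by blast
    also have "{x \<in> pts. \<forall>g \<in> carrier G. ?m g (orbit x) = orbit x} = Inv"
      using inv_iff by (auto simp only: Inv_def)
    finally show ?thesis .
  qed
  have can: "?can (horbit x) = (\<lambda>_. orbit x)" if x: "x \<in> pts" for x
  proof -
    have "orbit (ract h x) = orbit x" if "h \<in> carrier H" for h
      using x that by (auto simp: orbit_eq_iff)
    then have orbit_eq: "colim_rel (group_category H) (fix_left (group_category G) F ()) ``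
        {((), ract h x)} = orbit x" if "h \<in> carrier H" for h
      using x that orbit by simp
    have "colim_map (group_category H) (fix_left (group_category G) F ())
        (\<lambda>j x. x ()) (horbit x) = (\<Union>h \<in> carrier H.
        colim_rel (group_category H) (fix_left (group_category G) F ()) `` {((), ract h x)})"
      unfolding colim_map_def horbit_def by blast
    also have "\<dots> = (\<Union>h \<in> carrier H. orbit x)"
      using orbit_eq by (intro SUP_cong) auto
    also have "\<dots> = orbit x"
      using H.one_closed by blast
    finally have "colim_map (group_category H) (fix_left (group_category G) F ())
        (\<lambda>j x. x ()) (horbit x) = orbit x" .
    then show ?thesis
      by (auto simp: canonical_map_def restrict_def)
  qed
  \<comment> \<open>Turning the points of \<open>orbit x\<close> into constant families produces
    \<open>horbit x\<close>, so the orbit determines the source class. This is what makes the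
    canonical map injective.\<close>
  have horbit_cong: "horbit x = horbit y" if "orbit x = orbit y" for x y
  proof -
    have "horbit x = (\<lambda>(u, z). (u, \<lambda>_. z)) ` orbit x" for x
      by (auto simp: horbit_def orbit_def)
    with that show ?thesis by simp
  qed
  have inj: "inj_on ?can ?A"
    unfolding A
  proof (intro inj_onI, clarify)
    fix x y assume "x \<in> Fix" "y \<in> Fix" "?can (horbit x) = ?can (horbit y)"
    then have "orbit x = orbit y"
      using can by (simp add: Fix_def fun_eq_iff)
    then show "horbit x = horbit y" by (rule horbit_cong)
  qed
  have image: "?can ` ?A = (\<lambda>x _. orbit x) ` Fix"
    unfolding A image_image using can by (intro image_cong) (auto simp: Fix_def)
  \<comment> \<open>Being fixed spreads along an orbit: if \<open>x = h y\<close> and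
    \<open>G\<close> fixes \<open>y\<close>, then \<open>g x = h (g y) = h y = x\<close>. Equality
    of the two sets of orbits therefore gives \<open>Inv \<subseteq> Fix\<close>.\<close>
  have Fix_orbit: "x \<in> Fix" if "x \<in> pts" "y \<in> Fix" "orbit x = orbit y" for x y
    using that orbit_eq_iff[of x y] lact_ract by (auto simp: Fix_def)
  have "bij_betw ?can ?A ?B \<longleftrightarrow> (\<lambda>x (_::unit). orbit x) ` Fix = (\<lambda>x _. orbit x) ` Inv"
    using inj image B by (simp add: bij_betw_def)
  also have "\<dots> \<longleftrightarrow> Inv \<subseteq> Fix"
  proof
    assume eq: "(\<lambda>x (_::unit). orbit x) ` Fix = (\<lambda>x _. orbit x) ` Inv"
    show "Inv \<subseteq> Fix"
    proof
      fix x assume x: "x \<in> Inv"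
      then have "(\<lambda>_::unit. orbit x) \<in> (\<lambda>x (_::unit). orbit x) ` Fix"
        unfolding eq by blast
      then obtain y where "y \<in> Fix" "orbit x = orbit y"
        by (auto simp: fun_eq_iff)
      then show "x \<in> Fix" using Fix_orbit x by (auto simp: Inv_def)
    qed
  qed (use Fix_Inv in auto)
  also have "\<dots> \<longleftrightarrow> ?R"
    by (auto simp: Inv_def Fix_def)
  finally show ?thesis .
qed

section \<open>From a stable orbit to a subquotient\<close>

text \<open>
  For \<open>x\<close> whose orbit under \<open>H\<close> is stable under \<open>G\<close>, sending \<open>g\<close> to the \<open>h\<close> with
  \<open>g x = h\<inverse> x\<close> is multiplicative modulo the stabilizer of \<open>x\<close>; without the inverse it would
  reverse products.
\<close>

lemma stable_orbit_subquotient: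
  assumes x: "x \<in> pts" and stable: "\<forall>g \<in> carrier G. \<exists>h \<in> carrier H. lact g x = ract h x"
    and nontriv: "g0 \<in> carrier G" "lact g0 x \<noteq> x"
  shows "\<exists>N K L. N \<lhd> G \<and> \<not> trivial_group (G Mod N) \<and> subgroup K H \<and>
    L \<lhd> H\<lparr>carrier := K\<rparr> \<and> (G Mod N) \<cong> (H\<lparr>carrier := K\<rparr> Mod L)"
proof -
  define K where "K = {h \<in> carrier H. \<exists>g \<in> carrier G. lact g x = ract h x}"
  define L where "L = {h \<in> carrier H. ract h x = x}"
  let ?K = "H\<lparr>carrier := K\<rparr>"
  have K_inv: "inv\<^bsub>H\<^esub> h \<in> K \<and> lact (inv\<^bsub>G\<^esub> g) x = ract (inv\<^bsub>H\<^esub> h) x"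
    if "g \<in> carrier G" "h \<in> carrier H" "lact g x = ract h x" for g h
  proof -
    have "ract (inv\<^bsub>H\<^esub> h) x = lact (inv\<^bsub>G\<^esub> g) (lact g (ract (inv\<^bsub>H\<^esub> h) x))"
      using that x by simp
    also have "\<dots> = lact (inv\<^bsub>G\<^esub> g) x"
      using that x by (simp add: lact_ract)
    finally show ?thesis using that by (auto simp: K_def)
  qed
  \<comment> \<open>The order is reversed because
    \<open>g (g' x) = g (h' x) = h' (g x) = h' (h x)\<close>.\<close>
  have K_mult: "lact (g \<otimes>\<^bsub>G\<^esub> g') x = ract (h' \<otimes>\<^bsub>H\<^esub> h) x"
    if "g \<in> carrier G" "h \<in> carrier H" "lact g x = ract h x"
      "g' \<in> carrier G" "h' \<in> carrier H" "lact g' x = ract h' x" for g h g' h'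
    using that x by (simp add: lact_mult ract_mult lact_ract)
  have K: "subgroup K H"
  proof (rule H.subgroupI)
    show "K \<subseteq> carrier H" by (auto simp: K_def)
    have "\<one>\<^bsub>H\<^esub> \<in> K" using x by (auto simp: K_def intro!: bexI[of _ "\<one>\<^bsub>G\<^esub>"])
    then show "K \<noteq> {}" by blast
    show "inv\<^bsub>H\<^esub> h \<in> K" if "h \<in> K" for h
      using that K_inv by (auto simp: K_def)
    show "h \<otimes>\<^bsub>H\<^esub> h' \<in> K" if "h \<in> K" "h' \<in> K" for h h'
      using that K_mult by (fastforce simp: K_def)
  qed
  then interpret K: group ?K by (rule H.subgroup_imp_group)
  have K_carrier: "h \<in> carrier H" if "h \<in> K" for h
    using that by (simp add: K_def)
  have L_K: "L \<subseteq> K"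
    using x by (auto simp: K_def L_def intro!: bexI[of _ "\<one>\<^bsub>G\<^esub>"])
  have L: "subgroup L H"
  proof (rule H.subgroupI)
    show "inv\<^bsub>H\<^esub> h \<in> L" if "h \<in> L" for h
      using that ract_inv[OF x, of h] by (auto simp: L_def)
  qed (use x in \<open>auto simp: L_def ract_mult intro: exI[of _ "\<one>\<^bsub>H\<^esub>"]\<close>)
  have inv_K: "inv\<^bsub>?K\<^esub> h = inv\<^bsub>H\<^esub> h" if "h \<in> K" for h
    using H.m_inv_consistent[OF K that] by simp
  have L_normal: "L \<lhd> ?K"
  proof (rule K.normal_invI)
    show "subgroup L ?K"
      using H.subgroup_incl[OF L K L_K] .
    fix h l assume h: "h \<in> carrier ?K" and l: "l \<in> L"
    then have h': "h \<in> carrier H" "l \<in> carrier H" "ract l x = x" by (auto simp: K_def L_def)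
    \<comment> \<open>Replacing \<open>inv h\<close> at \<open>x\<close> by an element
      \<open>g\<close> of \<open>G\<close> lets it move past \<open>l\<close>:
      \<open>h l (inv h) x = h l g x = h g l x = h g x = x\<close>.\<close>
    obtain g where g: "g \<in> carrier G" "lact g x = ract (inv\<^bsub>H\<^esub> h) x"
      using h K_inv by (auto simp: K_def)
    have "ract (h \<otimes>\<^bsub>H\<^esub> l \<otimes>\<^bsub>H\<^esub> inv\<^bsub>H\<^esub> h) x = ract h (ract l (lact g x))"
      using x h' g by (simp add: ract_mult)
    also have "\<dots> = ract h (lact g x)"
      using lact_ract[OF x g(1) h'(2)] h'(3) by simp
    also have "\<dots> = x"
      using x h' g by (simp flip: ract_mult)
    finally show "h \<otimes>\<^bsub>?K\<^esub> l \<otimes>\<^bsub>?K\<^esub> inv\<^bsub>?K\<^esub> h \<in> L"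
      using h h' inv_K by (simp add: L_def)
  qed
  interpret L: normal L ?K by fact
  interpret Q: group "?K Mod L" by (rule L.factorgroup_is_group)
  \<comment> \<open>The choice is arbitrary within a coset of \<open>L\<close>, so \<open>s\<close>
    need not be multiplicative itself; only its coset matters.\<close>
  define s where "s g = (SOME h. h \<in> K \<and> lact g x = ract (inv\<^bsub>H\<^esub> h) x)" for g
  have s: "s g \<in> K" "lact g x = ract (inv\<^bsub>H\<^esub> (s g)) x" if g: "g \<in> carrier G" for g
  proof -
    obtain h where h: "h \<in> carrier H" "lact g x = ract h x"
      using bspec[OF stable g] by blast
    then have "inv\<^bsub>H\<^esub> h \<in> K \<and> lact g x = ract (inv\<^bsub>H\<^esub> (inv\<^bsub>H\<^esub> h)) x"
      using K_inv g by simp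
    then have "s g \<in> K \<and> lact g x = ract (inv\<^bsub>H\<^esub> (s g)) x"
      unfolding s_def by (rule someI)
    then show "s g \<in> K" "lact g x = ract (inv\<^bsub>H\<^esub> (s g)) x" by auto
  qed
  \<comment> \<open>The right coset of \<open>a\<close> is determined by the point
    \<open>inv a x\<close>, since \<open>a (inv b)\<close> stabilizes \<open>x\<close> exactly when
    \<open>inv b x = inv a x\<close>. For \<open>a = s g\<close> this point is
    \<open>g x\<close>.\<close>
  have coset_eq: "L #>\<^bsub>?K\<^esub> a = L #>\<^bsub>?K\<^esub> b \<longleftrightarrow> ract (inv\<^bsub>H\<^esub> a) x = ract (inv\<^bsub>H\<^esub> b) x"
    if "a \<in> K" "b \<in> K" for a b
  proof -
    have ab: "a \<in> carrier H" "b \<in> carrier H" using that K_carrier by auto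
    have "L #>\<^bsub>?K\<^esub> a = L #>\<^bsub>?K\<^esub> b \<longleftrightarrow> a \<otimes>\<^bsub>H\<^esub> inv\<^bsub>H\<^esub> b \<in> L"
    proof
      assume "L #>\<^bsub>?K\<^esub> a = L #>\<^bsub>?K\<^esub> b"
      then have "a \<in> L #>\<^bsub>?K\<^esub> b"
        using K.rcos_self[of a L] L.subgroup_axioms that by simp
      then obtain l where "l \<in> L" "a = l \<otimes>\<^bsub>H\<^esub> b"
        by (auto simp: r_coset_def)
      then show "a \<otimes>\<^bsub>H\<^esub> inv\<^bsub>H\<^esub> b \<in> L"
        using ab by (auto simp: L_def H.m_assoc)
    next
      assume l: "a \<otimes>\<^bsub>H\<^esub> inv\<^bsub>H\<^esub> b \<in> L"
      have "a = (a \<otimes>\<^bsub>H\<^esub> inv\<^bsub>H\<^esub> b) \<otimes>\<^bsub>H\<^esub> b"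
        using ab by (simp add: H.m_assoc)
      with l have "a \<in> L #>\<^bsub>?K\<^esub> b"
        by (auto simp: r_coset_def)
      then show "L #>\<^bsub>?K\<^esub> a = L #>\<^bsub>?K\<^esub> b"
        using K.repr_independence[OF _ _ L.subgroup_axioms, of a b] that by simp
    qed
    also have "\<dots> \<longleftrightarrow> ract (a \<otimes>\<^bsub>H\<^esub> inv\<^bsub>H\<^esub> b) x = x"
      using ab by (simp add: L_def)
    also have "\<dots> \<longleftrightarrow> ract (inv\<^bsub>H\<^esub> a) x = ract (inv\<^bsub>H\<^esub> b) x"
    proof
      assume "ract (a \<otimes>\<^bsub>H\<^esub> inv\<^bsub>H\<^esub> b) x = x"
      then have "ract (inv\<^bsub>H\<^esub> a) x = ract (inv\<^bsub>H\<^esub> a) (ract a (ract (inv\<^bsub>H\<^esub> b) x))"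
        using ab x by (simp add: ract_mult)
      then show "ract (inv\<^bsub>H\<^esub> a) x = ract (inv\<^bsub>H\<^esub> b) x"
        using ab x by simp
    next
      assume "ract (inv\<^bsub>H\<^esub> a) x = ract (inv\<^bsub>H\<^esub> b) x"
      then have "ract (a \<otimes>\<^bsub>H\<^esub> inv\<^bsub>H\<^esub> b) x = ract a (ract (inv\<^bsub>H\<^esub> a) x)"
        using ab x by (simp add: ract_mult)
      then show "ract (a \<otimes>\<^bsub>H\<^esub> inv\<^bsub>H\<^esub> b) x = x"
        using ab x by (simp flip: ract_mult)
    qed
    finally show ?thesis .
  qed
  define f where "f g = L #>\<^bsub>?K\<^esub> s g" for g
  have f_closed: "f g \<in> carrier (?K Mod L)" if "g \<in> carrier G" for g
    using s[OF that] by (auto simp: f_def FactGroup_def RCOSETS_def)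
  interpret f: group_hom G "?K Mod L" f
  proof (unfold_locales, rule homI)
    fix g g' assume g: "g \<in> carrier G" "g' \<in> carrier G"
    have sK: "s g \<otimes>\<^bsub>H\<^esub> s g' \<in> K"
      using s g K by (simp add: subgroup.m_closed)
    \<comment> \<open>The reversal in \<open>K_mult\<close> is cancelled by the reversal in the
      inverse of a product.\<close>
    have "lact (g \<otimes>\<^bsub>G\<^esub> g') x = ract (inv\<^bsub>H\<^esub> (s g') \<otimes>\<^bsub>H\<^esub> inv\<^bsub>H\<^esub> (s g)) x"
      using g s K_carrier by (intro K_mult) auto
    also have "\<dots> = ract (inv\<^bsub>H\<^esub> (s g \<otimes>\<^bsub>H\<^esub> s g')) x"
      using g s K_carrier by (simp add: H.inv_mult_group)
    finally have "f (g \<otimes>\<^bsub>G\<^esub> g') = L #>\<^bsub>?K\<^esub> (s g \<otimes>\<^bsub>H\<^esub> s g')"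
      using g s sK unfolding f_def by (subst coset_eq) auto
    then show "f (g \<otimes>\<^bsub>G\<^esub> g') = f g \<otimes>\<^bsub>?K Mod L\<^esub> f g'"
      using L.rcos_sum[of "s g" "s g'"] g s by (simp add: f_def FactGroup_def)
  qed (rule f_closed)
  have surj: "f ` carrier G = carrier (?K Mod L)"
  proof
    show "carrier (?K Mod L) \<subseteq> f ` carrier G"
    proof
      fix c assume "c \<in> carrier (?K Mod L)"
      then obtain h where h: "h \<in> K" "c = L #>\<^bsub>?K\<^esub> h"
        by (auto simp: FactGroup_def RCOSETS_def)
      then obtain g where g: "g \<in> carrier G" "lact g x = ract (inv\<^bsub>H\<^esub> h) x"
        using K_inv by (auto simp: K_def)
      \<comment> \<open>Both \<open>inv (s g)\<close> and \<open>inv h\<close> send \<open>x\<close>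
        to \<open>g x\<close>, so \<open>s g\<close> and \<open>h\<close> have the same
        coset.\<close>
      then have "f g = c"
        using h s unfolding f_def h(2) by (subst coset_eq) auto
      then show "c \<in> f ` carrier G" using g by blast
    qed
  qed (use f_closed in blast)
  let ?N = "kernel G (?K Mod L) f"
  \<comment> \<open>Comparing \<open>s g0\<close> with the unit through \<open>coset_eq\<close>,
    equality would say that \<open>g0\<close> fixes \<open>x\<close>. In the same way the kernel of
    \<open>f\<close> is the stabilizer of \<open>x\<close> in \<open>G\<close>.\<close>
  have "f g0 \<noteq> L #>\<^bsub>?K\<^esub> \<one>\<^bsub>H\<^esub>"
    using nontriv s[of g0] x subgroup.one_closed[OF K] unfolding f_def
    by (subst coset_eq) auto
  moreover have "L #>\<^bsub>?K\<^esub> \<one>\<^bsub>H\<^esub> = \<one>\<^bsub>?K Mod L\<^esub>"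
    using K.coset_mult_one[of L] L_K by (simp add: FactGroup_def)
  ultimately have ne: "f g0 \<noteq> \<one>\<^bsub>?K Mod L\<^esub>" by simp
  have iso: "G Mod ?N \<cong> ?K Mod L"
    by (rule f.FactGroup_iso[OF surj])
  have "\<not> trivial_group (G Mod ?N)"
  proof
    assume "trivial_group (G Mod ?N)"
    then have "trivial_group (?K Mod L)"
      using isomorphic_group_triviality[OF iso]
        normal.factorgroup_is_group[OF f.normal_kernel] Q.is_group by blast
    then show False
      using ne f_closed[OF nontriv(1)] by (auto simp: trivial_group_def)
  qed
  then show ?thesis
    using f.normal_kernel K L_normal iso by blast
qed

end

section \<open>From a subquotient to a diagram that violates commutation\<close>

text \<open>
  Conversely, \<open>G\<close> acts on the cosets \<open>L a\<close> in \<open>H\<close> by left multiplication through \<open>K/L\<close>, and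
  \<open>H\<close> by right multiplication with inverses.
\<close>

lemma subquotient_imp_not_commute:
  fixes G :: "('g, 'a) monoid_scheme" and H :: "('h, 'b) monoid_scheme"
  assumes G: "group G" and H: "group H"
    and universe: "carrier G \<times> carrier H \<lesssim> (UNIV :: 'u set)"
    and N: "N \<lhd> G" "\<not> trivial_group (G Mod N)"
    and K: "subgroup K H" and L: "L \<lhd> H\<lparr>carrier := K\<rparr>"
    and iso: "(G Mod N) \<cong> (H\<lparr>carrier := K\<rparr> Mod L)"
  shows "\<not> limits_commute_with_colimits TYPE('u) (group_category G) (group_category H)"
proof
  assume commute: "limits_commute_with_colimits TYPE('u) (group_category G) (group_category H)"
  interpret G: group G by fact
  interpret H: group H by fact
  interpret N: normal N G by fact
  interpret GN: group "G Mod N" by (rule N.factorgroup_is_group)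
  let ?K = "H\<lparr>carrier := K\<rparr>"
  interpret K: group ?K using K by (rule H.subgroup_imp_group)
  interpret L: normal L ?K by fact
  interpret KL: group "?K Mod L" by (rule L.factorgroup_is_group)
  have KH: "K \<subseteq> carrier H" using K by (rule subgroup.subset)
  have LK: "L \<subseteq> K" using L.subset by simp
  have LH: "L \<subseteq> carrier H" using LK KH by blast
  have coset_K: "L #>\<^bsub>?K\<^esub> a = L #>\<^bsub>H\<^esub> a" for a
    by (simp add: r_coset_def)
  have mult_K: "A <#>\<^bsub>?K\<^esub> B = A <#>\<^bsub>H\<^esub> B" for A B
    by (simp add: set_mult_def)
  have L_coset_one: "L #>\<^bsub>H\<^esub> \<one>\<^bsub>H\<^esub> = L"
    using LH by (rule H.coset_mult_one)
  obtain \<phi> where "\<phi> \<in> iso (G Mod N) (?K Mod L)"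
    using iso by (auto simp: is_iso_def)
  then interpret \<phi>: group_hom "G Mod N" "?K Mod L" \<phi>
    by unfold_locales (simp add: iso_def)
  have \<phi>_inj: "inj_on \<phi> (carrier (G Mod N))"
    using \<open>\<phi> \<in> _\<close> by (simp add: iso_def bij_betw_def)
  \<comment> \<open>This is the composite of the projection \<open>G \<rightarrow> G/N\<close> with
    the isomorphism onto \<open>K/L\<close>; its values are cosets of \<open>L\<close>, used below
    as subsets of \<open>H\<close>.\<close>
  define p where "p g = \<phi> (N #>\<^bsub>G\<^esub> g)" for g
  have N_coset: "N #>\<^bsub>G\<^esub> g \<in> carrier (G Mod N)" if "g \<in> carrier G" for g
    using that by (auto simp: FactGroup_def RCOSETS_def)
  have p_coset: "\<exists>k \<in> K. p g = L #>\<^bsub>H\<^esub> k" if "g \<in> carrier G" for g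
    using \<phi>.hom_closed[OF N_coset[OF that]]
    by (auto simp: p_def FactGroup_def RCOSETS_def coset_K)
  have p_sub: "p g \<subseteq> carrier H" if "g \<in> carrier G" for g
    using p_coset[OF that] LH KH H.r_coset_subset_G by blast
  have p_mult: "p (g \<otimes>\<^bsub>G\<^esub> g') = p g <#>\<^bsub>H\<^esub> p g'"
    if "g \<in> carrier G" "g' \<in> carrier G" for g g'
  proof -
    have "N #>\<^bsub>G\<^esub> (g \<otimes>\<^bsub>G\<^esub> g') = (N #>\<^bsub>G\<^esub> g) \<otimes>\<^bsub>G Mod N\<^esub> (N #>\<^bsub>G\<^esub> g')"
      using that N.rcos_sum by (simp add: FactGroup_def)
    then show ?thesis
      using that \<phi>.hom_mult[OF N_coset N_coset, of g g']
      by (simp add: p_def FactGroup_def mult_K)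
  qed
  have one_GN: "N #>\<^bsub>G\<^esub> \<one>\<^bsub>G\<^esub> = \<one>\<^bsub>G Mod N\<^esub>"
    using G.coset_mult_one[OF N.subset] by (simp add: FactGroup_def)
  have p_one: "p \<one>\<^bsub>G\<^esub> = L"
    using \<phi>.hom_one by (simp add: p_def one_GN)
  \<comment> \<open>\<open>L\<close> is normal only in \<open>K\<close>, while \<open>a\<close>
    ranges over \<open>H\<close>. Normality is applied to \<open>k\<close> alone, giving
    \<open>(L k) L = L k\<close>, and the factor \<open>a\<close> is then carried along by
    associativity.\<close>
  have coset_mult: "(L #>\<^bsub>H\<^esub> k) <#>\<^bsub>H\<^esub> (L #>\<^bsub>H\<^esub> a) = L #>\<^bsub>H\<^esub> (k \<otimes>\<^bsub>H\<^esub> a)"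
    if "k \<in> K" "a \<in> carrier H" for k a
  proof -
    have "(L #>\<^bsub>H\<^esub> k) <#>\<^bsub>H\<^esub> L = (L #>\<^bsub>?K\<^esub> k) <#>\<^bsub>?K\<^esub> (L #>\<^bsub>?K\<^esub> \<one>\<^bsub>?K\<^esub>)"
      by (simp add: coset_K mult_K L_coset_one)
    also have "\<dots> = L #>\<^bsub>H\<^esub> k"
      using L.rcos_sum[of k "\<one>\<^bsub>?K\<^esub>"] that K.r_one[of k] K.one_closed by (simp add: coset_K)
    finally show ?thesis
      using that LH KH H.setmult_rcos_assoc[of "L #>\<^bsub>H\<^esub> k" L a] H.r_coset_subset_G[OF LH, of k]
      by (auto simp: H.coset_mult_assoc)
  qed
  define C where "C = (\<lambda>a. L #>\<^bsub>H\<^esub> a) ` carrier H"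
  \<comment> \<open>The cosets must be coded in the universe \<open>'u\<close>: choosing
    representatives embeds them into \<open>H\<close>, and \<open>H\<close> embeds into the product
    as \<open>(1, h)\<close>. The map \<open>e\<close> encodes and \<open>d\<close> decodes.\<close>
  have "C \<lesssim> carrier H"
    unfolding C_def by (rule image_lepoll)
  also have "carrier H \<lesssim> carrier G \<times> carrier H"
    unfolding lepoll_def by (rule exI[of _ "Pair \<one>\<^bsub>G\<^esub>"]) (auto simp: inj_on_def)
  also note universe
  finally obtain e :: "_ \<Rightarrow> 'u" where e: "inj_on e C"
    by (auto simp: lepoll_def)
  define d where "d = inv_into C e"
  have d [simp]: "d (e S) = S" if "S \<in> C" for S
    using e that by (simp add: d_def)
  \<comment> \<open>The inverse makes right multiplication a left action of \<open>H\<close>; the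
    two actions commute because they multiply on opposite sides.\<close>
  define A where "A g h S = (p g <#>\<^bsub>H\<^esub> S) #>\<^bsub>H\<^esub> inv\<^bsub>H\<^esub> h" for g h S
  have A_closed: "A g h S \<in> C"
    if g: "g \<in> carrier G" and h: "h \<in> carrier H" and S: "S \<in> C" for g h S
  proof -
    obtain k a where k: "k \<in> K" "p g = L #>\<^bsub>H\<^esub> k" and a: "a \<in> carrier H" "S = L #>\<^bsub>H\<^esub> a"
      using p_coset[OF g] S by (auto simp: C_def)
    have kH: "k \<in> carrier H" using k KH by blast
    have "A g h S = (L #>\<^bsub>H\<^esub> (k \<otimes>\<^bsub>H\<^esub> a)) #>\<^bsub>H\<^esub> inv\<^bsub>H\<^esub> h"
      by (simp only: A_def k(2) a(2) coset_mult[OF k(1) a(1)])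
    also have "\<dots> = L #>\<^bsub>H\<^esub> (k \<otimes>\<^bsub>H\<^esub> a \<otimes>\<^bsub>H\<^esub> inv\<^bsub>H\<^esub> h)"
      using kH a(1) h LH by (intro H.coset_mult_assoc) auto
    finally show ?thesis
      using kH a(1) h unfolding C_def by blast
  qed
  have C_sub: "S \<subseteq> carrier H" if "S \<in> C" for S
    using that LH H.r_coset_subset_G by (auto simp: C_def)
  have A_mult: "A (g \<otimes>\<^bsub>G\<^esub> g') (h \<otimes>\<^bsub>H\<^esub> h') S = A g h (A g' h' S)"
    if "g \<in> carrier G" "g' \<in> carrier G" "h \<in> carrier H" "h' \<in> carrier H" "S \<in> C" for g g' h h' S
  proof -
    have sub: "p g \<subseteq> carrier H" "p g' \<subseteq> carrier H" "S \<subseteq> carrier H"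
      using that p_sub C_sub by auto
    note sub' = H.set_mult_closed[OF sub(2,3)]
    have "A g h (A g' h' S) = ((p g <#>\<^bsub>H\<^esub> (p g' <#>\<^bsub>H\<^esub> S)) #>\<^bsub>H\<^esub> inv\<^bsub>H\<^esub> h') #>\<^bsub>H\<^esub> inv\<^bsub>H\<^esub> h"
      using that sub sub' by (simp add: A_def H.setmult_rcos_assoc)
    also have "\<dots> = (p g <#>\<^bsub>H\<^esub> (p g' <#>\<^bsub>H\<^esub> S)) #>\<^bsub>H\<^esub> (inv\<^bsub>H\<^esub> h' \<otimes>\<^bsub>H\<^esub> inv\<^bsub>H\<^esub> h)"
      using that sub(1) sub' by (simp add: H.coset_mult_assoc H.set_mult_closed)
    also have "\<dots> = A (g \<otimes>\<^bsub>G\<^esub> g') (h \<otimes>\<^bsub>H\<^esub> h') S"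
      using that sub by (simp add: A_def p_mult H.set_mult_assoc H.inv_mult_group)
    finally show ?thesis by simp
  qed
  have A_one: "A \<one>\<^bsub>G\<^esub> \<one>\<^bsub>H\<^esub> S = S" if S: "S \<in> C" for S
  proof -
    obtain a where a: "a \<in> carrier H" "S = L #>\<^bsub>H\<^esub> a"
      using S by (auto simp: C_def)
    have "L <#>\<^bsub>H\<^esub> S = S"
      using coset_mult[of "\<one>\<^bsub>H\<^esub>" a] a subgroup.one_closed[OF K] by (simp add: L_coset_one)
    then show ?thesis
      using C_sub[OF S] by (simp add: A_def p_one)
  qed
  define F :: "(unit \<times> unit, 'g \<times> 'h, 'u) set_diagram"
    where "F = \<lparr>fobj = \<lambda>_. e ` C, farr = \<lambda>(g, h) u. e (A g h (d u))\<rparr>"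
  have F: "set_functor (prod_category (group_category G) (group_category H)) F"
    by (auto simp: set_functor_def prod_category_def F_def
        A_closed A_one A_mult)
  then interpret F: commuting_actions G H F
    by unfold_locales
  have pts: "F.pts = e ` C"
    unfolding F.pts_def by (simp add: F_def)
  have lact_eq: "F.lact g u = e (A g \<one>\<^bsub>H\<^esub> (d u))" for g u
    unfolding F.lact_def by (simp add: F_def)
  have ract_eq: "F.ract h u = e (A \<one>\<^bsub>G\<^esub> h (d u))" for h u
    unfolding F.ract_def by (simp add: F_def)
  \<comment> \<open>The test point is the coset \<open>L\<close>, which \<open>g\<close> sends to
    \<open>p g\<close>.\<close>
  have L_C: "L \<in> C"
    using L_coset_one by (force simp: C_def)
  have eL: "e L \<in> F.pts"
    using L_C by (simp add: pts)
  have lact: "F.lact g (e L) = e (p g)" if g: "g \<in> carrier G" for g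
  proof -
    obtain k where k: "k \<in> K" "p g = L #>\<^bsub>H\<^esub> k"
      using p_coset[OF g] by blast
    have "p g <#>\<^bsub>H\<^esub> L = p g"
      using coset_mult[of k "\<one>\<^bsub>H\<^esub>"] k KH by (auto simp: L_coset_one)
    then show ?thesis
      using L_C p_sub[OF g] by (simp add: lact_eq A_def)
  qed
  have "\<exists>h \<in> carrier H. F.lact g (e L) = F.ract h (e L)" if g: "g \<in> carrier G" for g
  proof -
    obtain k where k: "k \<in> K" "p g = L #>\<^bsub>H\<^esub> k"
      using p_coset[OF g] by blast
    \<comment> \<open>If \<open>p g = L k\<close>, the element \<open>inv k\<close> of
      \<open>H\<close> also sends \<open>L\<close> to \<open>L k\<close>, as right multiplication
      uses the inverse. So the orbit of \<open>L\<close> is stable under \<open>G\<close>.\<close>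
    have "F.ract (inv\<^bsub>H\<^esub> k) (e L) = e (L #>\<^bsub>H\<^esub> k)"
      using L_C k KH coset_mult[of "\<one>\<^bsub>H\<^esub>" "\<one>\<^bsub>H\<^esub>"] subgroup.one_closed[OF K]
      by (auto simp: ract_eq A_def p_one L_coset_one)
    then show ?thesis
      using lact[OF g] k KH by (intro bexI[of _ "inv\<^bsub>H\<^esub> k"]) auto
  qed
  then have fixed: "F.lact g (e L) = e L" if "g \<in> carrier G" for g
    using commute F F.bij_canonical_map_iff eL that
    unfolding limits_commute_with_colimits_def by blast
  \<comment> \<open>Since \<open>G\<close> fixes \<open>L\<close>, every \<open>p g\<close> equals
    \<open>L\<close>; injectivity of \<open>\<phi>\<close> then collapses
    \<open>G Mod N\<close>.\<close>
  have "c = \<one>\<^bsub>G Mod N\<^esub>" if c: "c \<in> carrier (G Mod N)" for c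
  proof -
    obtain g where g: "g \<in> carrier G" "c = N #>\<^bsub>G\<^esub> g"
      using c by (auto simp: FactGroup_def RCOSETS_def)
    have "p g \<in> C"
      using p_coset[OF g(1)] KH by (auto simp: C_def)
    then have "p g = L"
      using inj_onD[OF e, of "p g" L] fixed lact g L_C by simp
    then have "\<phi> c = \<phi> \<one>\<^bsub>G Mod N\<^esub>"
      using p_one g by (simp add: p_def one_GN)
    then show ?thesis
      using inj_onD[OF \<phi>_inj] c GN.one_closed by blast
  qed
  then have "trivial_group (G Mod N)"
    using GN.is_group GN.one_closed by (auto simp: trivial_group_def)
  with N(2) show False by blast
qed

theorem lemma3p2:
  fixes G :: "('g, 'a) monoid_scheme" and H :: "('h, 'b) monoid_scheme"
  assumes "group G" and "group H"
    and universe: "carrier G \<times> carrier H \<lesssim> (UNIV :: 'u set)"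
  shows "limits_commute_with_colimits TYPE('u) (group_category G) (group_category H) \<longleftrightarrow>
    \<not> (\<exists>N K L. N \<lhd> G \<and> \<not> trivial_group (G Mod N) \<and>
        subgroup K H \<and> L \<lhd> H\<lparr>carrier := K\<rparr> \<and>
        (G Mod N) \<cong> (H\<lparr>carrier := K\<rparr> Mod L))"
    (is "_ \<longleftrightarrow> \<not> ?Q")
proof
  show "\<not> ?Q" if "limits_commute_with_colimits TYPE('u) (group_category G) (group_category H)"
    using that subquotient_imp_not_commute[OF assms] by blast
  show "limits_commute_with_colimits TYPE('u) (group_category G) (group_category H)" if "\<not> ?Q"
    unfolding limits_commute_with_colimits_def
  proof (intro allI impI)
    fix F :: "(unit \<times> unit, 'g \<times> 'h, 'u) set_diagram"
    assume "set_functor (prod_category (group_category G) (group_category H)) F"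
    then interpret commuting_actions G H F
      using assms by (simp add: commuting_actions_def commuting_actions_axioms_def)
    show "bij_betw (canonical_map (group_category G) (group_category H) F)
      (set_colim (group_category H) (lim_diagram (group_category G) (group_category H) F))
      (set_lim (group_category G) (colim_diagram (group_category G) (group_category H) F))"
      \<comment> \<open>A point with a stable orbit that is moved by some element of
        \<open>G\<close> would produce the subquotient excluded by \<open>\<not> ?Q\<close>.\<close>
      unfolding bij_canonical_map_iff using stable_orbit_subquotient that by blast
  qed
qed

end
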